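(* Let $(x^{\mathrm{PP}},y^{\mathrm{PP}},\mu^{\mathrm{PP}},\nu^{\mathrm{PP}})$ be an optimal solution of the personalized pricing problem PP and let $(x^{\mathrm{UP}},y^{\mathrm{UP}},\mu^{\mathrm{UP}},\nu^{\mathrm{UP}})$ be an optimal solution of the uniform pricing problem UP (with the same data). Let $n_{\mathrm{PP}}(N)=|\{i\in N\mid y_i^{\mathrm{PP}}>0\}|$ and $n_{\mathrm{UP}}(N)=|\{i\in N\mid y_i^{\mathrm{UP}}>0\}|$ be the numbers of prosumers who participate in the personalized and uniform pricing scheme, respectively. Then $n_{\mathrm{UP}}(N)\le n_{\mathrm{PP}}(N)$.
   Context: Let $N=\{1,\dots,n\}$ (the prosumers). The given data are real numbers $a_i>0$, $m_i>0$, $b_i\in\mathbb{R}$ ($i\in N$), $p>0$, $f>0$ and $\bar\rho\ge 0$. For reals $s,t$, the notation $0\le s\perp t\ge 0$ means $s\ge 0$, $t\ge 0$ and $st=0$. Prosumer $i$ participates if its flexibility $y_i$ at the optimal solution is positive. Problem PP (personalized pricing), in the variables $x,y,\mu,\nu\in\mathbb{R}^n$: minimize $\sum_{i\in N}(x_i-p)y_i+pf$ subject to $\sum_{i\in N}y_i\le f$ and, for all $i\in N$: $0\le x_i\le\bar\rho$, $\ y_i=\frac{x_i-b_i+\mu_i-\nu_i}{a_i}$, $\ 0\le y_i\perp\mu_i\ge 0$, $\ 0\le m_i-y_i\perp\nu_i\ge 0$. Problem UP (uniform pricing), in the variables $x\in\mathbb{R}$ and $y,\mu,\nu\in\mathbb{R}^n$: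 minimize $\sum_{i\in N}(x-p)y_i+pf$ subject to $0\le x\le\bar\rho$, $\ \sum_{i\in N}y_i\le f$ and, for all $i\in N$: $\ y_i=\frac{x-b_i+\mu_i-\nu_i}{a_i}$, $\ 0\le y_i\perp\mu_i\ge 0$, $\ 0\le m_i-y_i\perp\nu_i\ge 0$. *)

theory Defs
  imports "HOL-Analysis.Analysis"
begin

definition complementary :: "real \<Rightarrow> real \<Rightarrow> bool"
  where "complementary s t \<longleftrightarrow> s \<ge> 0 \<and> t \<ge> 0 \<and> s * t = 0"

text \<open>
  PP is personalized pricing, with one price \<open>x $ i\<close> per prosumer; UP is uniform pricing, with a
  single price \<open>x\<close>. The prosumers are the elements of the finite index type \<open>'n\<close>; a point is a
  tuple \<open>(x, y, \<mu>, \<nu>)\<close>, and an optimal solution is a global minimizer of the objective over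
  the feasible points, not necessarily unique.
\<close>

definition PP_feasible ::
  "real ^ 'n \<Rightarrow> real ^ 'n \<Rightarrow> real ^ 'n \<Rightarrow> real \<Rightarrow> real \<Rightarrow>
    (real ^ 'n) \<times> (real ^ 'n) \<times> (real ^ 'n) \<times> (real ^ 'n) \<Rightarrow> bool"
  where "PP_feasible a m b f \<rho> = (\<lambda>(x, y, \<mu>, \<nu>).
    (\<Sum>i\<in>UNIV. y $ i) \<le> f \<and>
    (\<forall>i. 0 \<le> x $ i \<and> x $ i \<le> \<rho> \<and>
         y $ i = (x $ i - b $ i + \<mu> $ i - \<nu> $ i) / a $ i \<and>
         complementary (y $ i) (\<mu> $ i) \<and>
         complementary (m $ i - y $ i) (\<nu> $ i)))"

definition PP_objective ::
  "real \<Rightarrow> real \<Rightarrow> (real ^ 'n) \<times> (real ^ 'n) \<times> (real ^ 'n) \<times> (real ^ 'n) \<Rightarrow> real"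
  where "PP_objective p f = (\<lambda>(x, y, \<mu>, \<nu>). (\<Sum>i\<in>UNIV. (x $ i - p) * y $ i) + p * f)"

definition PP_optimal ::
  "real ^ 'n \<Rightarrow> real ^ 'n \<Rightarrow> real ^ 'n \<Rightarrow> real \<Rightarrow> real \<Rightarrow> real \<Rightarrow>
    (real ^ 'n) \<times> (real ^ 'n) \<times> (real ^ 'n) \<times> (real ^ 'n) \<Rightarrow> bool"
  where "PP_optimal a m b p f \<rho> = is_arg_min (PP_objective p f) (PP_feasible a m b f \<rho>)"

definition UP_feasible ::
  "real ^ 'n \<Rightarrow> real ^ 'n \<Rightarrow> real ^ 'n \<Rightarrow> real \<Rightarrow> real \<Rightarrow>
    real \<times> (real ^ 'n) \<times> (real ^ 'n) \<times> (real ^ 'n) \<Rightarrow> bool"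
  where "UP_feasible a m b f \<rho> = (\<lambda>(x, y, \<mu>, \<nu>).
    0 \<le> x \<and> x \<le> \<rho> \<and>
    (\<Sum>i\<in>UNIV. y $ i) \<le> f \<and>
    (\<forall>i. y $ i = (x - b $ i + \<mu> $ i - \<nu> $ i) / a $ i \<and>
         complementary (y $ i) (\<mu> $ i) \<and>
         complementary (m $ i - y $ i) (\<nu> $ i)))"

definition UP_objective ::
  "real \<Rightarrow> real \<Rightarrow> real \<times> (real ^ 'n) \<times> (real ^ 'n) \<times> (real ^ 'n) \<Rightarrow> real"
  where "UP_objective p f = (\<lambda>(x, y, \<mu>, \<nu>). (\<Sum>i\<in>UNIV. (x - p) * y $ i) + p * f)"

definition UP_optimal ::
  "real ^ 'n \<Rightarrow> real ^ 'n \<Rightarrow> real ^ 'n \<Rightarrow> real \<Rightarrow> real \<Rightarrow> real \<Rightarrow>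
    real \<times> (real ^ 'n) \<times> (real ^ 'n) \<times> (real ^ 'n) \<Rightarrow> bool"
  where "UP_optimal a m b p f \<rho> = is_arg_min (UP_objective p f) (UP_feasible a m b f \<rho>)"

definition num_participants :: "real ^ 'n \<Rightarrow> nat"
  where "num_participants y = card {i. y $ i > 0}"

end

theory Submission
  imports Defs
begin

text \<open>
  Every prosumer \<open>i\<close> that participates under uniform pricing also participates under personalized
  pricing, so the two sets of participants are nested, not merely ordered in size.

  The constraints on a single prosumer say that \<open>y\<close> is \<open>(x - b) / a\<close> clamped to \<open>[0, m]\<close>. Hence,
  as long as the price \<open>b + a * y\<close> lies in \<open>[0, \<rho>]\<close>, personalized pricing can buy \<open>y\<close> at that price,
  and it never buys a positive \<open>y\<close> more cheaply.

  Suppose that \<open>i\<close> has \<open>y_UP $ i > 0\<close> and \<open>y_PP $ i = 0\<close>. The latter forces \<open>b $ i \<ge> 0\<close>, the former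
  \<open>b $ i < x_UP\<close>, so that small amounts of \<open>i\<close> can be bought at personalized prices below \<open>x_UP\<close>.
  Moreover \<open>x_UP \<le> p\<close>: otherwise the uniform price \<open>p\<close>, which costs exactly \<open>p * f\<close>, would be
  better (\<open>UP_price_le\<close>). The optimum of PP can then be improved in either of two ways
  (\<open>PP_exchange\<close>).

  \<^item> If \<open>y_PP\<close> leaves some of \<open>f\<close> unused, buy a little from \<open>i\<close> at a price below \<open>p\<close>.

  \<^item> If \<open>y_PP\<close> uses all of \<open>f\<close>, then some \<open>j\<close> has \<open>y_PP $ j > y_UP $ j\<close>, because \<open>i\<close> supplies less
    than under UP and the total supply is at least that of UP. The price paid to \<open>j\<close> exceeds
    \<open>x_UP\<close>, since \<open>j\<close> would not supply more than \<open>y_UP $ j\<close> for \<open>x_UP\<close>. Shifting a small amount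
    from \<open>j\<close> to \<open>i\<close> replaces expensive by cheap flexibility, and it lowers the price of all that
    \<open>j\<close> still supplies.
\<close>

section \<open>The response of a single prosumer\<close>

definition response :: "real \<Rightarrow> real \<Rightarrow> real \<Rightarrow> real \<Rightarrow> real \<Rightarrow> real \<Rightarrow> real \<Rightarrow> bool"
  where "response a m b x y \<mu> \<nu> \<longleftrightarrow>
    y = (x - b + \<mu> - \<nu>) / a \<and> complementary y \<mu> \<and> complementary (m - y) \<nu>"

lemma PP_feasible_iff:
  "PP_feasible a m b f \<rho> (x, y, \<mu>, \<nu>) \<longleftrightarrow>
    (\<Sum>i\<in>UNIV. y $ i) \<le> f \<and>
    (\<forall>i. 0 \<le> x $ i \<and> x $ i \<le> \<rho> \<and> response (a $ i) (m $ i) (b $ i) (x $ i) (y $ i) (\<mu> $ i) (\<nu> $ i))"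
  by (simp add: PP_feasible_def response_def)

lemma UP_feasible_iff:
  "UP_feasible a m b f \<rho> (x, y, \<mu>, \<nu>) \<longleftrightarrow>
    0 \<le> x \<and> x \<le> \<rho> \<and> (\<Sum>i\<in>UNIV. y $ i) \<le> f \<and>
    (\<forall>i. response (a $ i) (m $ i) (b $ i) x (y $ i) (\<mu> $ i) (\<nu> $ i))"
  by (simp add: UP_feasible_def response_def)

lemma response_bounds:
  assumes "response a m b x y \<mu> \<nu>"
  shows "0 \<le> y" "y \<le> m"
  using assms by (auto simp: response_def complementary_def)

lemma response_balance:
  assumes "a > 0" "response a m b x y \<mu> \<nu>"
  shows "a * y = x - b + \<mu> - \<nu>"
  using assms by (simp add: response_def)

lemma response_price_ge:
  assumes "a > 0" "response a m b x y \<mu> \<nu>" "y > 0"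
  shows "b + a * y \<le> x"
  using response_balance[OF assms(1,2)] assms(2,3)
  by (auto simp: response_def complementary_def)

lemma response_price_le:
  assumes "a > 0" "response a m b x y \<mu> \<nu>" "y < m"
  shows "x \<le> b + a * y"
  using response_balance[OF assms(1,2)] assms(2,3)
  by (auto simp: response_def complementary_def)

lemma response_mono:
  assumes "a > 0" "response a m b x y \<mu> \<nu>" "response a m b x' y' \<mu>' \<nu>'" "x < x'"
  shows "y \<le> y'"
proof (rule ccontr)
  assume "\<not> y \<le> y'"
  then have "y' < y" by simp
  moreover have "0 \<le> y'" "y \<le> m"
    using assms response_bounds by blast+
  ultimately have "b + a * y \<le> x" "x' \<le> b + a * y'"
    using assms response_price_ge response_price_le by auto
  moreover have "a * y' < a * y"
    using \<open>y' < y\<close> \<open>a > 0\<close> by simp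
  ultimately show False
    using \<open>x < x'\<close> by linarith
qed

lemma response_at_marginal_price:
  assumes "a > 0" "0 \<le> y" "y \<le> m"
  shows "response a m b (b + a * y) y 0 0"
  using assms by (simp add: response_def complementary_def)

lemma response_exists:
  assumes "a > 0" "m > 0"
  obtains y \<mu> \<nu> where "response a m b x y \<mu> \<nu>"
proof -
  consider "x \<le> b" | "b < x" "x \<le> b + a * m" | "b + a * m < x"
    by linarith
  then show thesis
  proof cases
    case 1
    then have "response a m b x 0 (b - x) 0"
      using assms by (simp add: response_def complementary_def)
    then show ?thesis by (rule that)
  next
    case 2
    then have "response a m b x ((x - b) / a) 0 0"
      using assms by (simp add: response_def complementary_def field_simps)
    then show ?thesis by (rule that)
  next
    case 3
    then have "response a m b x m 0 (x - b - a * m)"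
      using assms by (simp add: response_def complementary_def)
    then show ?thesis by (rule that)
  qed
qed

section \<open>Uniform pricing: a bound on the price\<close>

text \<open>
  At the price \<open>p\<close> the objective is \<open>p * f\<close> whatever is bought. This price is feasible if a higher one
  is, because supply increases with the price; and a price above \<open>p\<close> is strictly worse as soon as
  somebody supplies something.
\<close>

lemma UP_price_le:
  fixes a m b y \<mu> \<nu> :: "real ^ 'n"
  assumes a: "\<And>i. a $ i > 0" and m: "\<And>i. m $ i > 0" and p: "p > 0"
    and opt: "UP_optimal a m b p f \<rho> (x, y, \<mu>, \<nu>)"
    and i: "y $ i > 0"
  shows "x \<le> p"
proof (rule ccontr)
  assume "\<not> x \<le> p"
  then have "p < x" by simp
  have feas: "UP_feasible a m b f \<rho> (x, y, \<mu>, \<nu>)"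
    using opt by (simp add: UP_optimal_def is_arg_min_def)
  then have resp: "response (a $ k) (m $ k) (b $ k) x (y $ k) (\<mu> $ k) (\<nu> $ k)" for k
    by (simp add: UP_feasible_iff)
  have "\<exists>z s t. response (a $ k) (m $ k) (b $ k) p z s t" for k
    using response_exists[OF a m] by metis
  then obtain z s t where z: "\<And>k. response (a $ k) (m $ k) (b $ k) p (z k) (s k) (t k)"
    by metis
  have "(\<Sum>k\<in>UNIV. z k) \<le> (\<Sum>k\<in>UNIV. y $ k)"
    by (intro sum_mono response_mono[OF a z resp \<open>p < x\<close>])
  then have "UP_feasible a m b f \<rho> (p, vec_lambda z, vec_lambda s, vec_lambda t)"
    using feas z p \<open>p < x\<close> by (simp add: UP_feasible_iff)
  then have "\<not> UP_objective p f (p, vec_lambda z, vec_lambda s, vec_lambda t)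
      < UP_objective p f (x, y, \<mu>, \<nu>)"
    using opt by (auto simp: UP_optimal_def is_arg_min_def)
  moreover have "0 < (\<Sum>k\<in>UNIV. (x - p) * y $ k)"
    using i \<open>p < x\<close> response_bounds(1)[OF resp] by (intro sum_pos2[of _ i]) auto
  ultimately show False
    by (simp add: UP_objective_def)
qed

section \<open>Personalized pricing: improving a plan on some coordinates\<close>

text \<open>
  Personalized prices are independent of each other, so the plan can be changed on a set \<open>S\<close> of
  prosumers only, buying \<open>Y k\<close> at the price \<open>b $ k + a $ k * Y k\<close>. At an optimum such a change
  cannot lower the part of the objective that belongs to \<open>S\<close>.
\<close>

lemma PP_exchange:
  fixes a m b x y \<mu> \<nu> :: "real ^ 'n" and Y :: "'n \<Rightarrow> real"
  assumes a: "\<And>i. a $ i > 0"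
    and opt: "PP_optimal a m b p f \<rho> (x, y, \<mu>, \<nu>)"
    and quantity: "\<And>k. k \<in> S \<Longrightarrow> 0 \<le> Y k \<and> Y k \<le> m $ k"
    and price: "\<And>k. k \<in> S \<Longrightarrow> 0 \<le> b $ k + a $ k * Y k \<and> b $ k + a $ k * Y k \<le> \<rho>"
    and total: "(\<Sum>k\<in>S. Y k) + (\<Sum>k\<in>UNIV. y $ k) \<le> (\<Sum>k\<in>S. y $ k) + f"
  shows "(\<Sum>k\<in>S. (x $ k - p) * y $ k) \<le> (\<Sum>k\<in>S. (b $ k + a $ k * Y k - p) * Y k)"
proof -
  have feas: "PP_feasible a m b f \<rho> (x, y, \<mu>, \<nu>)"
    using opt by (simp add: PP_optimal_def is_arg_min_def)
  define x' y' \<mu>' \<nu>' :: "real ^ 'n" where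
    "x' = (\<chi> k. if k \<in> S then b $ k + a $ k * Y k else x $ k)" and
    "y' = (\<chi> k. if k \<in> S then Y k else y $ k)" and
    "\<mu>' = (\<chi> k. if k \<in> S then 0 else \<mu> $ k)" and
    "\<nu>' = (\<chi> k. if k \<in> S then 0 else \<nu> $ k)"
  note new_defs = x'_def y'_def \<mu>'_def \<nu>'_def
  have split: "(\<Sum>k\<in>UNIV. g k) = (\<Sum>k\<in>S. g k) + (\<Sum>k\<in>- S. g k)" for g :: "'n \<Rightarrow> real"
    using sum.subset_diff[of S UNIV g] by (simp add: Compl_eq_Diff_UNIV)
  have "(\<Sum>k\<in>UNIV. y' $ k) = (\<Sum>k\<in>S. Y k) + (\<Sum>k\<in>- S. y $ k)"
    unfolding split by (simp add: new_defs)
  also have "\<dots> \<le> f"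
    using total split[of "\<lambda>k. y $ k"] by simp
  finally have "PP_feasible a m b f \<rho> (x', y', \<mu>', \<nu>')"
    using feas a quantity price response_at_marginal_price
    by (auto simp: PP_feasible_iff new_defs)
  then have "\<not> PP_objective p f (x', y', \<mu>', \<nu>') < PP_objective p f (x, y, \<mu>, \<nu>)"
    using opt by (auto simp: PP_optimal_def is_arg_min_def)
  then show ?thesis
    unfolding PP_objective_def split by (simp add: new_defs)
qed

section \<open>Nested sets of participants\<close>

lemma UP_participant_imp_PP_participant:
  fixes a m b x_PP y_PP \<mu>_PP \<nu>_PP y_UP \<mu>_UP \<nu>_UP :: "real ^ 'n"
  assumes a: "\<And>i. a $ i > 0" and m: "\<And>i. m $ i > 0" and p: "p > 0"
    and PP: "PP_optimal a m b p f \<rho> (x_PP, y_PP, \<mu>_PP, \<nu>_PP)"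
    and UP: "UP_optimal a m b p f \<rho> (x_UP, y_UP, \<mu>_UP, \<nu>_UP)"
    and i: "y_UP $ i > 0"
  shows "y_PP $ i > 0"
proof (rule ccontr)
  have PPf: "PP_feasible a m b f \<rho> (x_PP, y_PP, \<mu>_PP, \<nu>_PP)"
    using PP by (simp add: PP_optimal_def is_arg_min_def)
  have UPf: "UP_feasible a m b f \<rho> (x_UP, y_UP, \<mu>_UP, \<nu>_UP)"
    using UP by (simp add: UP_optimal_def is_arg_min_def)
  have PPr: "response (a $ k) (m $ k) (b $ k) (x_PP $ k) (y_PP $ k) (\<mu>_PP $ k) (\<nu>_PP $ k)"
    and PPx: "0 \<le> x_PP $ k" "x_PP $ k \<le> \<rho>" for k
    using PPf by (simp_all add: PP_feasible_iff)
  have UPr: "response (a $ k) (m $ k) (b $ k) x_UP (y_UP $ k) (\<mu>_UP $ k) (\<nu>_UP $ k)" for k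
    using UPf by (simp add: UP_feasible_iff)
  have UPx: "0 \<le> x_UP" "x_UP \<le> \<rho>"
    using UPf by (simp_all add: UP_feasible_iff)
  assume "\<not> y_PP $ i > 0"
  then have yi: "y_PP $ i = 0"
    using response_bounds(1)[OF PPr[of i]] by simp
  have bi: "0 \<le> b $ i"
    using response_price_le[OF a PPr[of i]] PPx(1)[of i] m[of i] yi by simp
  have UPi: "b $ i + a $ i * y_UP $ i \<le> x_UP"
    using response_price_ge[OF a UPr i] .
  have xp: "x_UP \<le> p"
    using UP_price_le[OF a m p UP i] .
  have quantity_i: "0 \<le> e \<and> e \<le> m $ i"
    and cheap: "0 \<le> b $ i + a $ i * e" "b $ i + a $ i * e \<le> x_UP"
    if "0 < e" "e \<le> y_UP $ i" for e
  proof -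
    have "a $ i * e \<le> a $ i * y_UP $ i" "0 \<le> a $ i * e"
      using that a[of i] by simp_all
    then show "0 \<le> b $ i + a $ i * e" "b $ i + a $ i * e \<le> x_UP"
      using bi UPi by linarith+
    show "0 \<le> e \<and> e \<le> m $ i"
      using that response_bounds(2)[OF UPr[of i]] by linarith
  qed
  show False
  proof (cases "(\<Sum>k\<in>UNIV. y_PP $ k) < f")
    case True
    \<comment> \<open>Half of \<open>y_UP $ i\<close> keeps the price of \<open>i\<close> strictly below \<open>x_UP\<close>, hence below \<open>p\<close>.\<close>
    define e where "e = min (y_UP $ i / 2) (f - (\<Sum>k\<in>UNIV. y_PP $ k))"
    have e: "0 < e" "e < y_UP $ i" "e \<le> f - (\<Sum>k\<in>UNIV. y_PP $ k)"
      using True i by (auto simp: e_def)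
    have "a $ i * e < a $ i * y_UP $ i"
      using e a[of i] by simp
    then have "(b $ i + a $ i * e - p) * e < 0"
      using UPi xp e(1) by (intro mult_neg_pos) linarith+
    moreover have "(\<Sum>k\<in>{i}. (x_PP $ k - p) * y_PP $ k)
        \<le> (\<Sum>k\<in>{i}. (b $ k + a $ k * e - p) * e)"
      using e quantity_i[of e] cheap[of e] UPx yi by (intro PP_exchange[OF a PP]) auto
    ultimately show False
      using yi by simp
  next
    case False
    have "\<exists>j. y_UP $ j < y_PP $ j"
    proof (rule ccontr)
      assume "\<not> ?thesis"
      then have "\<And>k. y_PP $ k \<le> y_UP $ k"
        by (simp add: not_less)
      then have "(\<Sum>k\<in>UNIV. y_PP $ k) < (\<Sum>k\<in>UNIV. y_UP $ k)"
        using i yi by (intro sum_strict_mono_ex1) (auto intro!: exI[of _ i])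
      then show False
        using False UPf by (simp add: UP_feasible_iff)
    qed
    then obtain j where j: "y_UP $ j < y_PP $ j" ..
    have ij: "i \<noteq> j"
      using i yi j by auto
    have yj: "0 \<le> y_UP $ j" "y_PP $ j \<le> m $ j"
      using response_bounds PPr UPr by blast+
    have UPj: "x_UP \<le> b $ j + a $ j * y_UP $ j"
      using response_price_le[OF a UPr] j yj by simp
    have PPj: "b $ j + a $ j * y_PP $ j \<le> x_PP $ j"
      using response_price_ge[OF a PPr] j yj by simp
    \<comment> \<open>Take as much as possible such that \<open>i\<close> supplies at most, and \<open>j\<close> at least, what they supply
      under UP: this keeps the new price of \<open>i\<close> at most, and that of \<open>j\<close> at least, \<open>x_UP\<close>.\<close>
    define e where "e = min (y_UP $ i) (y_PP $ j - y_UP $ j)"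
    have e: "0 < e" "e \<le> y_UP $ i" "e \<le> y_PP $ j - y_UP $ j"
      using i j by (auto simp: e_def)
    define Y where "Y k = (if k = i then e else y_PP $ j - e)" for k
    have Y: "Y i = e" "Y j = y_PP $ j - e"
      using ij by (simp_all add: Y_def)
    have price_j: "a $ j * y_UP $ j \<le> a $ j * (y_PP $ j - e)"
      "a $ j * (y_PP $ j - e) < a $ j * y_PP $ j"
      using e a[of j] by simp_all
    have "(\<Sum>k\<in>{i, j}. (x_PP $ k - p) * y_PP $ k)
        \<le> (\<Sum>k\<in>{i, j}. (b $ k + a $ k * Y k - p) * Y k)"
    proof (rule PP_exchange[OF a PP])
      show "0 \<le> Y k \<and> Y k \<le> m $ k" if "k \<in> {i, j}" for k
        using that quantity_i[OF e(1,2)] e yj by (auto simp: Y)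
      show "0 \<le> b $ k + a $ k * Y k \<and> b $ k + a $ k * Y k \<le> \<rho>" if "k \<in> {i, j}" for k
        using that cheap[OF e(1,2)] UPx UPj PPj PPx(2)[of j] price_j by (auto simp: Y)
      show "(\<Sum>k\<in>{i, j}. Y k) + (\<Sum>k\<in>UNIV. y_PP $ k) \<le> (\<Sum>k\<in>{i, j}. y_PP $ k) + f"
        using ij yi PPf by (simp add: Y PP_feasible_iff)
    qed
    then have "(x_PP $ j - p) * y_PP $ j
        \<le> (b $ i + a $ i * e - p) * e + (b $ j + a $ j * (y_PP $ j - e) - p) * (y_PP $ j - e)"
      using ij yi by (simp add: Y)
    moreover have "(b $ j + a $ j * y_PP $ j) * y_PP $ j \<le> x_PP $ j * y_PP $ j"
      using PPj j yj by (intro mult_right_mono) auto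
    \<comment> \<open>The terms with \<open>p\<close> cancel, because the total is unchanged.\<close>
    ultimately have "0 \<le> e * ((b $ i + a $ i * e) - (b $ j + a $ j * y_PP $ j)
        - a $ j * (y_PP $ j - e))"
      by (simp add: algebra_simps)
    moreover have "0 \<le> a $ j * y_UP $ j"
      using a[of j] yj by simp
    then have "(b $ i + a $ i * e) - (b $ j + a $ j * y_PP $ j) - a $ j * (y_PP $ j - e) < 0"
      using cheap(2)[OF e(1,2)] UPj price_j by linarith
    ultimately show False
      using e(1) by (simp add: zero_le_mult_iff)
  qed
qed

theorem proposition9:
  fixes a m b :: "real ^ 'n"
    and p f \<rho> :: real
    and x_PP y_PP \<mu>_PP \<nu>_PP :: "real ^ 'n"
    and x_UP :: real
    and y_UP \<mu>_UP \<nu>_UP :: "real ^ 'n"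
  assumes "\<And>i. a $ i > 0"
    and "\<And>i. m $ i > 0"
    and "p > 0"
    and "f > 0"
    and "\<rho> \<ge> 0"
    and "PP_optimal a m b p f \<rho> (x_PP, y_PP, \<mu>_PP, \<nu>_PP)"
    and "UP_optimal a m b p f \<rho> (x_UP, y_UP, \<mu>_UP, \<nu>_UP)"
  shows "num_participants y_UP \<le> num_participants y_PP"
  unfolding num_participants_def
  using UP_participant_imp_PP_participant[OF assms(1-3,6,7)]
  by (intro card_mono) auto

end
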